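(* Let $\mathbb{K}$ be $\mathbb{Q}$ or $\mathbb{R}$. Consider a loop $\texttt{while }(c)\,\{\,P;\,\}$ over variables $\vec s=(s_1,\dots,s_m)$ with values in $\mathbb{K}$, where $c$ is a linear test and $P$ is a loop-free program. Let $G:=c\land\llbracket P\rrbracket$, a formula in $\vec s$ and $\vec{s'}$ expressing that $\vec{s'}$ can be reached from $\vec s$ in exactly one iteration of the loop. Let $$F \;:=\; L_1(\vec s)\le p_1\land\dots\land L_n(\vec s)\le p_n,\qquad F' \;:=\; L'_1(\vec s)\le p'_1\land\dots\land L'_{n'}(\vec s)\le p'_{n'}$$ be template constraints for, respectively, the precondition of the loop and the invariant, where the $L_j$ and $L'_j$ are fixed linear forms and $\vec p=(p_1,\dots,p_n)$, $\vec{p'}=(p'_1,\dots,p'_{n'})$ are parameters. Define $$H \;:=\; \bigl(\forall\vec s\;(F\Rightarrow F')\bigr)\land\bigl(\forall\vec s,\vec{s'}\;(F'\land G\Rightarrow F'[\vec{s'}/\vec s])\bigr),$$ and, for $1\le i\le n'$, the formula with free variables $p_1,\dots,p_n,p'_i$ $$O'_i \;:=\; \bigl(\exists p'_1,\dots,p'_{i-1},p'_{i+1},\dots,p'_{n'}\;H\bigr)\land\bigl(\forall\vec{q'}\;(H[\vec{q'}/\vec{p'}]\Rightarrow p'_i\le q'_i)\bigr).$$ Then $O'_i$ defines the least value of $p'_i$ for an inductive invariant, containing the precondition states, of the shape defined by $F'$ for the transition relation defined by $G$. That is, for all $\vec p\in\mathbb{K}^n$ and $p'_i\in\mathbb{K}$,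 $(\vec p,p'_i)$ satisfies $O'_i$ if and only if $p'_i$ is the least element of the set of $i$-th coordinates $q'_i$ of those $\vec{q'}\in\mathbb{K}^{n'}$ for which $W_{\vec{q'}}:=\{\vec s\in\mathbb{K}^m : L'_j(\vec s)\le q'_j\text{ for all }1\le j\le n'\}$ is an inductive invariant for $G$ that contains $\{\vec s\in\mathbb{K}^m : L_j(\vec s)\le p_j\text{ for all }1\le j\le n\}$.
   Context: All variables and quantifiers range over $\mathbb{K}$. $A[\vec y/\vec x]$ denotes the substitution of $\vec y$ for $\vec x$ in $A$. A set $W\subseteq\mathbb{K}^m$ is an inductive invariant (for the head of the loop, with transition relation $G$) if for all $\vec s\in W$ and all $\vec{s'}$, $(\vec s,\vec{s'})\models G$ implies $\vec{s'}\in W$. A linear test is made of linear inequalities in $\vec s$. Loop-free programs over variables $a,b,c,\dots$ (here named $s_1,\dots,s_m$) are built from the constructs below. The semantics of a program $P$ is a formula $\llbracket P\rrbracket$ in unprimed variables (values at the beginning of execution) and primed variables (values at the end): - Assignment: $\llbracket a:=L(a,b,\dots)+K\rrbracket$ is $a'=L(a,b,\dots)+K\land b'=b\land c'=c\land\cdots$, where $L$ is a linear form and $K\in\mathbb{K}$ is a constant. - Test: $\llbracket \texttt{if } t\texttt{ then }P_1\texttt{ else }P_2\rrbracket$ is $(t\land\llbracket P_1\rrbracket)\lor(\neg t\land\llbracket P_2\rrbracket)$, where $t$ is a linear test in the unprimed variables. - Nondeterministic choice: $\llbracket a:=\texttt{random}\rrbracket$ is $b'=b\land c'=c\land\cdots$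 (for all variables except $a$; $a'$ is unconstrained). - Failure: $\llbracket\texttt{fail}\rrbracket$ is false. - Skip: $\llbracket\texttt{skip}\rrbracket$ is $a'=a\land b'=b\land c'=c\land\cdots$. - Sequence: $\llbracket P_1;P_2\rrbracket$ is $\exists a'',b'',\dots\;(f_1\land f_2)$, where $f_1$ is $\llbracket P_1\rrbracket$ with each primed variable replaced by the corresponding double-primed one, and $f_2$ is $\llbracket P_2\rrbracket$ with each unprimed variable replaced by the corresponding double-primed one. *)

theory Defs
  imports Complex_Main
begin

text \<open>
  Program variables, template parameters and vector components are numbered from 0.
  Elements of \<open>K^m\<close> are lists of length \<open>m\<close>; a linear form on \<open>K^m\<close> is the list of its
  \<open>m\<close> coefficients. The field \<open>K\<close> is a type \<open>'k\<close>, so that all quantifiers range over \<open>K\<close>.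
\<close>

section \<open>First-order formulas over linear atoms\<close>

text \<open>
  \<open>Sv i\<close>, \<open>Sv' i\<close>, \<open>Sv'' i\<close> are the unprimed, primed and double-primed copies of the \<open>i\<close>-th
  program variable; \<open>Pv j\<close>, \<open>Pv' j\<close>, \<open>Qv' j\<close> are the parameters \<open>p\<close>, \<open>p'\<close>, \<open>q'\<close>.
\<close>

datatype var = Sv nat | Sv' nat | Sv'' nat | Pv nat | Pv' nat | Qv' nat

text \<open>\<open>Aff [(c1, x1), \<dots>] k\<close> is the affine term \<open>c1 * x1 + \<dots> + k\<close>.\<close>

datatype 'k aff = Aff "('k \<times> var) list" 'k

datatype 'k fm =
    Tru
  | Fls
  | Le "'k aff" "'k aff"
  | Lt "'k aff" "'k aff"
  | Eq "'k aff" "'k aff"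
  | Neg "'k fm"
  | And "'k fm" "'k fm"
  | Or "'k fm" "'k fm"
  | Imp "'k fm" "'k fm"
  | Ex var "'k fm"
  | All var "'k fm"

fun aff_val :: "(var \<Rightarrow> 'k::linordered_field) \<Rightarrow> 'k aff \<Rightarrow> 'k" where
  "aff_val v (Aff cs k) = (\<Sum>(c, x) \<leftarrow> cs. c * v x) + k"

fun sat :: "(var \<Rightarrow> 'k::linordered_field) \<Rightarrow> 'k fm \<Rightarrow> bool" where
  "sat v Tru = True"
| "sat v Fls = False"
| "sat v (Le t u) = (aff_val v t \<le> aff_val v u)"
| "sat v (Lt t u) = (aff_val v t < aff_val v u)"
| "sat v (Eq t u) = (aff_val v t = aff_val v u)"
| "sat v (Neg A) = (\<not> sat v A)"
| "sat v (And A B) = (sat v A \<and> sat v B)"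
| "sat v (Or A B) = (sat v A \<or> sat v B)"
| "sat v (Imp A B) = (sat v A \<longrightarrow> sat v B)"
| "sat v (Ex x A) = (\<exists>a. sat (v(x := a)) A)"
| "sat v (All x A) = (\<forall>a. sat (v(x := a)) A)"

definition models :: "var list \<Rightarrow> 'k list \<Rightarrow> 'k::linordered_field fm \<Rightarrow> bool" where
  \<comment> \<open>Variables outside \<open>xs\<close> get the value 0; this is used only for formulas whose free
      variables are among \<open>xs\<close>.\<close>
  "models xs as A = sat (\<lambda>x. case map_of (zip xs as) x of Some a \<Rightarrow> a | None \<Rightarrow> 0) A"

fun aff_vars :: "'k aff \<Rightarrow> var set" where
  "aff_vars (Aff cs k) = snd ` set cs"

fun fv :: "'k fm \<Rightarrow> var set" where
  "fv Tru = {}"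
| "fv Fls = {}"
| "fv (Le t u) = aff_vars t \<union> aff_vars u"
| "fv (Lt t u) = aff_vars t \<union> aff_vars u"
| "fv (Eq t u) = aff_vars t \<union> aff_vars u"
| "fv (Neg A) = fv A"
| "fv (And A B) = fv A \<union> fv B"
| "fv (Or A B) = fv A \<union> fv B"
| "fv (Imp A B) = fv A \<union> fv B"
| "fv (Ex x A) = fv A - {x}"
| "fv (All x A) = fv A - {x}"

definition Conj :: "'k fm list \<Rightarrow> 'k fm" where
  "Conj As = foldr And As Tru"

definition Exs :: "var list \<Rightarrow> 'k fm \<Rightarrow> 'k fm" where
  "Exs xs A = foldr Ex xs A"

definition Alls :: "var list \<Rightarrow> 'k fm \<Rightarrow> 'k fm" where
  "Alls xs A = foldr All xs A"

subsection \<open>Capture-avoiding substitution of variables for variables\<close>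

text \<open>
  Capture has to be avoided: the semantics of nested sequences substitutes double-primed
  variables into formulas that already bind them. \<open>fresh_for x Y\<close> keeps the bound name \<open>x\<close>
  unless it would capture a variable in \<open>Y\<close>.
\<close>

definition fresh_for :: "var \<Rightarrow> var set \<Rightarrow> var" where
  "fresh_for x Y = (if x \<notin> Y then x else (SOME y. y \<notin> Y))"

fun aff_rename :: "(var \<Rightarrow> var) \<Rightarrow> 'k aff \<Rightarrow> 'k aff" where
  "aff_rename \<sigma> (Aff cs k) = Aff (map (\<lambda>(c, x). (c, \<sigma> x)) cs) k"

fun rename :: "(var \<Rightarrow> var) \<Rightarrow> 'k fm \<Rightarrow> 'k fm" where
  "rename \<sigma> Tru = Tru"
| "rename \<sigma> Fls = Fls"
| "rename \<sigma> (Le t u) = Le (aff_rename \<sigma> t) (aff_rename \<sigma> u)"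
| "rename \<sigma> (Lt t u) = Lt (aff_rename \<sigma> t) (aff_rename \<sigma> u)"
| "rename \<sigma> (Eq t u) = Eq (aff_rename \<sigma> t) (aff_rename \<sigma> u)"
| "rename \<sigma> (Neg A) = Neg (rename \<sigma> A)"
| "rename \<sigma> (And A B) = And (rename \<sigma> A) (rename \<sigma> B)"
| "rename \<sigma> (Or A B) = Or (rename \<sigma> A) (rename \<sigma> B)"
| "rename \<sigma> (Imp A B) = Imp (rename \<sigma> A) (rename \<sigma> B)"
| "rename \<sigma> (Ex x A) =
     (let y = fresh_for x (\<sigma> ` (fv A - {x})) in Ex y (rename (\<sigma>(x := y)) A))"
| "rename \<sigma> (All x A) =
     (let y = fresh_for x (\<sigma> ` (fv A - {x})) in All y (rename (\<sigma>(x := y)) A))"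

definition subst :: "'k fm \<Rightarrow> var list \<Rightarrow> var list \<Rightarrow> 'k fm" where
  \<comment> \<open>\<open>subst A ys xs\<close> is \<open>A[ys/xs]\<close>: \<open>ys\<close> replace \<open>xs\<close>.\<close>
  "subst A ys xs = rename (\<lambda>x. case map_of (zip xs ys) x of Some y \<Rightarrow> y | None \<Rightarrow> x) A"

section \<open>Linear forms, tests and programs\<close>

definition svars :: "nat \<Rightarrow> var list" where "svars m = map Sv [0..<m]"
definition svars' :: "nat \<Rightarrow> var list" where "svars' m = map Sv' [0..<m]"
definition svars'' :: "nat \<Rightarrow> var list" where "svars'' m = map Sv'' [0..<m]"
definition pvars :: "nat \<Rightarrow> var list" where "pvars n = map Pv [0..<n]"
definition pvars' :: "nat \<Rightarrow> var list" where "pvars' n = map Pv' [0..<n]"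
definition qvars' :: "nat \<Rightarrow> var list" where "qvars' n = map Qv' [0..<n]"

definition lin :: "'k::linordered_field list \<Rightarrow> 'k list \<Rightarrow> 'k" where
  "lin L s = (\<Sum>(c, a) \<leftarrow> zip L s. c * a)"

definition affine :: "nat \<Rightarrow> 'k list \<Rightarrow> 'k \<Rightarrow> 'k aff" where
  "affine m L k = Aff (zip L (svars m)) k"

definition var_aff :: "var \<Rightarrow> 'k::linordered_field aff" where
  "var_aff x = Aff [(1, x)] 0"

text \<open>Boolean combinations of linear inequalities in the unprimed program variables.\<close>

fun linear_test :: "nat \<Rightarrow> 'k fm \<Rightarrow> bool" where
  "linear_test m (Le t u) = (aff_vars t \<union> aff_vars u \<subseteq> set (svars m))"
| "linear_test m (Lt t u) = (aff_vars t \<union> aff_vars u \<subseteq> set (svars m))"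
| "linear_test m (Neg A) = linear_test m A"
| "linear_test m (And A B) = (linear_test m A \<and> linear_test m B)"
| "linear_test m (Or A B) = (linear_test m A \<and> linear_test m B)"
| "linear_test m _ = False"

text \<open>\<open>Assign a L k\<close> is \<open>a := L(s) + k\<close>; \<open>Random a\<close> is \<open>a := random\<close>.\<close>

datatype 'k prog =
    Assign nat "'k list" 'k
  | Ite "'k fm" "'k prog" "'k prog"
  | Random nat
  | Fail
  | Skip
  | Seq "'k prog" "'k prog"

fun wf_prog :: "nat \<Rightarrow> 'k prog \<Rightarrow> bool" where
  "wf_prog m (Assign a L k) = (a < m \<and> length L = m)"
| "wf_prog m (Ite t C D) = (linear_test m t \<and> wf_prog m C \<and> wf_prog m D)"
| "wf_prog m (Random a) = (a < m)"
| "wf_prog m Fail = True"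
| "wf_prog m Skip = True"
| "wf_prog m (Seq C D) = (wf_prog m C \<and> wf_prog m D)"

definition unchanged :: "nat list \<Rightarrow> 'k::linordered_field fm" where
  "unchanged bs = Conj (map (\<lambda>b. Eq (var_aff (Sv' b)) (var_aff (Sv b))) bs)"

fun sem :: "nat \<Rightarrow> 'k::linordered_field prog \<Rightarrow> 'k fm" where
  "sem m (Assign a L k) =
     And (Eq (var_aff (Sv' a)) (affine m L k)) (unchanged [b \<leftarrow> [0..<m]. b \<noteq> a])"
| "sem m (Ite t C D) = Or (And t (sem m C)) (And (Neg t) (sem m D))"
| "sem m (Random a) = unchanged [b \<leftarrow> [0..<m]. b \<noteq> a]"
| "sem m Fail = Fls"
| "sem m Skip = unchanged [0..<m]"
| "sem m (Seq C D) =
     Exs (svars'' m) (And (subst (sem m C) (svars'' m) (svars' m))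
                            (subst (sem m D) (svars'' m) (svars m)))"

definition loop_fm :: "nat \<Rightarrow> 'k::linordered_field fm \<Rightarrow> 'k prog \<Rightarrow> 'k fm" where
  "loop_fm m c C = And c (sem m C)"

section \<open>Templates and the formulas $H$ and $O'_i$\<close>

definition linear_forms :: "nat \<Rightarrow> 'k list list \<Rightarrow> bool" where
  "linear_forms m Ls = (\<forall>L \<in> set Ls. length L = m)"

definition template :: "nat \<Rightarrow> 'k::linordered_field list list \<Rightarrow> var list \<Rightarrow> 'k fm" where
  "template m Ls xs = Conj (map (\<lambda>(L, x). Le (affine m L 0) (var_aff x)) (zip Ls xs))"

definition H_fm ::
  "nat \<Rightarrow> 'k::linordered_field list list \<Rightarrow> 'k list list \<Rightarrow> 'k fm \<Rightarrow> 'k fm" where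
  "H_fm m Ls Ls' G =
     (let F = template m Ls (pvars (length Ls));
          F' = template m Ls' (pvars' (length Ls'))
      in And (Alls (svars m) (Imp F F'))
             (Alls (svars m @ svars' m) (Imp (And F' G) (subst F' (svars' m) (svars m)))))"

definition O_fm ::
  "nat \<Rightarrow> 'k::linordered_field list list \<Rightarrow> 'k list list \<Rightarrow> 'k fm \<Rightarrow> nat \<Rightarrow> 'k fm" where
  "O_fm m Ls Ls' G i =
     (let n' = length Ls'; H = H_fm m Ls Ls' G
      in And (Exs (map Pv' [j \<leftarrow> [0..<n']. j \<noteq> i]) H)
             (Alls (qvars' n')
               (Imp (subst H (qvars' n') (pvars' n')) (Le (var_aff (Pv' i)) (var_aff (Qv' i))))))"

section \<open>Inductive invariants\<close>

definition region :: "nat \<Rightarrow> 'k::linordered_field list list \<Rightarrow> 'k list \<Rightarrow> 'k list set" where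
  "region m Ls q = {s. length s = m \<and> (\<forall>j < length Ls. lin (Ls ! j) s \<le> q ! j)}"

definition inductive_invariant ::
  "nat \<Rightarrow> 'k::linordered_field fm \<Rightarrow> 'k list set \<Rightarrow> bool" where
  "inductive_invariant m G W \<longleftrightarrow>
     W \<subseteq> {s. length s = m} \<and>
     (\<forall>s \<in> W. \<forall>s'. length s' = m \<longrightarrow> models (svars m @ svars' m) (s @ s') G \<longrightarrow> s' \<in> W)"

definition least_element :: "'a::order set \<Rightarrow> 'a \<Rightarrow> bool" where
  "least_element A a \<longleftrightarrow> a \<in> A \<and> (\<forall>b \<in> A. a \<le> b)"

end

theory Submission
  imports Defs
begin

text \<open>
  Every formula is evaluated semantically: renaming variables is precomposition of the valuation,
  and a block of quantifiers ranges over the valuations agreeing with the given one outside the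
  block. In this way \<open>H\<close> says exactly that the region given by \<open>p'\<close> is an inductive invariant
  containing the region given by \<open>p\<close>. The two conjuncts of \<open>O'_i\<close> are then membership and
  minimality. The only fact needed about programs is that their semantics has no free variables
  other than the unprimed and primed program variables.
\<close>

section \<open>Valuations\<close>

text \<open>Simultaneous override along a list. It is polymorphic because it plays two roles: over a
  valuation it assigns field values, and over the identity it is the variable map of
  \<open>subst\<close>.\<close>

definition upd :: "('x \<Rightarrow> 'y) \<Rightarrow> 'x list \<Rightarrow> 'y list \<Rightarrow> 'x \<Rightarrow> 'y" where
  "upd v xs as x = (case map_of (zip xs as) x of Some a \<Rightarrow> a | None \<Rightarrow> v x)"

lemma upd_notin: "x \<notin> set xs \<Longrightarrow> upd v xs as x = v x"
  by (auto simp: upd_def split: option.split dest!: map_of_SomeD set_zip_leftD)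

lemma upd_nth:
  "\<lbrakk>distinct xs; length as = length xs; j < length xs\<rbrakk> \<Longrightarrow> upd v xs as (xs ! j) = as ! j"
  by (simp add: upd_def map_of_zip_nth)

lemma map_upd: "\<lbrakk>distinct xs; length as = length xs\<rbrakk> \<Longrightarrow> map (upd v xs as) xs = as"
  by (rule nth_equalityI) (auto simp: upd_nth)

lemma models_upd: "models xs as A \<longleftrightarrow> sat (upd (\<lambda>_. 0) xs as) A"
  by (simp add: models_def upd_def[abs_def])

lemma subst_upd: "subst A ys xs = rename (upd (\<lambda>x. x) xs ys) A"
  by (simp add: subst_def upd_def[abs_def])

section \<open>Satisfaction depends only on the free variables\<close>

lemma aff_val_cong: "(\<And>x. x \<in> aff_vars t \<Longrightarrow> v x = w x) \<Longrightarrow> aff_val v t = aff_val w t"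
proof (cases t)
  case (Aff cs k)
  assume "\<And>x. x \<in> aff_vars t \<Longrightarrow> v x = w x"
  then have "map (\<lambda>(c, x). c * v x) cs = map (\<lambda>(c, x). c * w x) cs"
    unfolding Aff by (intro map_cong) force+
  then show ?thesis unfolding Aff by (simp only: aff_val.simps)
qed

lemma sat_cong: "(\<And>x. x \<in> fv A \<Longrightarrow> v x = w x) \<Longrightarrow> sat v A \<longleftrightarrow> sat w A"
proof (induction A arbitrary: v w)
  case (Le t u)
  then show ?case using aff_val_cong[of t v w] aff_val_cong[of u v w] by simp
next
  case (Lt t u)
  then show ?case using aff_val_cong[of t v w] aff_val_cong[of u v w] by simp
next
  case (Eq t u)
  then show ?case using aff_val_cong[of t v w] aff_val_cong[of u v w] by simp
next
  case (Neg A)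
  have "sat v A \<longleftrightarrow> sat w A" by (rule Neg.IH) (simp add: Neg.prems)
  then show ?case by simp
next
  case (And A B)
  have "sat v A \<longleftrightarrow> sat w A" by (rule And.IH(1)) (simp add: And.prems)
  moreover have "sat v B \<longleftrightarrow> sat w B" by (rule And.IH(2)) (simp add: And.prems)
  ultimately show ?case by simp
next
  case (Or A B)
  have "sat v A \<longleftrightarrow> sat w A" by (rule Or.IH(1)) (simp add: Or.prems)
  moreover have "sat v B \<longleftrightarrow> sat w B" by (rule Or.IH(2)) (simp add: Or.prems)
  ultimately show ?case by simp
next
  case (Imp A B)
  have "sat v A \<longleftrightarrow> sat w A" by (rule Imp.IH(1)) (simp add: Imp.prems)
  moreover have "sat v B \<longleftrightarrow> sat w B" by (rule Imp.IH(2)) (simp add: Imp.prems)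
  ultimately show ?case by simp
next
  case (Ex x A)
  \<comment> \<open>Agreement is assumed only off \<open>x\<close>; at \<open>x\<close> both updated
    valuations return \<open>a\<close>.\<close>
  have "sat (v(x := a)) A \<longleftrightarrow> sat (w(x := a)) A" for a
    by (rule Ex.IH) (use Ex.prems in auto)
  then show ?case by simp
next
  case (All x A)
  have "sat (v(x := a)) A \<longleftrightarrow> sat (w(x := a)) A" for a
    by (rule All.IH) (use All.prems in auto)
  then show ?case by simp
qed auto

section \<open>Renaming and substitution\<close>

lemma finite_fv: "finite (fv A)"
proof -
  have "finite (aff_vars t)" for t :: "'a aff" by (cases t) simp
  then show ?thesis by (induction A) auto
qed

lemma fresh_for_notin: "finite Y \<Longrightarrow> fresh_for x Y \<notin> Y"
proof -
  assume "finite Y"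
  \<comment> \<open>The constructor \<open>Sv\<close> injects the naturals into \<open>var\<close>,
    so a finite set never exhausts the names and the \<open>SOME\<close> in \<open>fresh_for\<close>
    has a witness.\<close>
  moreover have "infinite (UNIV :: var set)"
    using infinite_iff_countable_subset[of "UNIV :: var set"] by (metis injI subset_UNIV var.inject(1))
  ultimately have "\<exists>y. y \<notin> Y" by (rule ex_new_if_finite[rotated])
  then show ?thesis unfolding fresh_for_def by (metis someI_ex)
qed

lemma aff_val_rename: "aff_val v (aff_rename \<sigma> t) = aff_val (v \<circ> \<sigma>) t"
  by (cases t) (simp add: o_def split_def)

lemma sat_rename: "sat v (rename \<sigma> A) \<longleftrightarrow> sat (v \<circ> \<sigma>) A"
proof (induction A arbitrary: v \<sigma>)
  case (Ex x A)
  define y where "y = fresh_for x (\<sigma> ` (fv A - {x}))"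
  have y: "y \<notin> \<sigma> ` (fv A - {x})"
    unfolding y_def by (rule fresh_for_notin) (simp add: finite_fv)
  \<comment> \<open>Capture avoidance enters here: \<open>x\<close> is sent to \<open>y\<close> and
    so reads \<open>a\<close>, while every other free variable is sent to a name different from
    \<open>y\<close> and does not see the update.\<close>
  have "sat (v(y := a) \<circ> \<sigma>(x := y)) A \<longleftrightarrow> sat ((v \<circ> \<sigma>)(x := a)) A" for a
    by (rule sat_cong) (use y in auto)
  then show ?case by (simp add: Ex.IH Let_def del: o_apply fun_upd_apply flip: y_def)
next
  case (All x A)
  define y where "y = fresh_for x (\<sigma> ` (fv A - {x}))"
  have y: "y \<notin> \<sigma> ` (fv A - {x})"
    unfolding y_def by (rule fresh_for_notin) (simp add: finite_fv)
  have "sat (v(y := a) \<circ> \<sigma>(x := y)) A \<longleftrightarrow> sat ((v \<circ> \<sigma>)(x := a)) A" for a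
    by (rule sat_cong) (use y in auto)
  then show ?case by (simp add: All.IH Let_def del: o_apply fun_upd_apply flip: y_def)
qed (auto simp: aff_val_rename)

lemma aff_vars_rename: "aff_vars (aff_rename \<sigma> t) = \<sigma> ` aff_vars t"
  by (cases t) force

text \<open>Under a quantifier, the image \<open>y\<close> of the bound variable is bound again, so
  only images of the other free variables survive.\<close>

lemma fv_rename: "fv (rename \<sigma> A) \<subseteq> \<sigma> ` fv A"
proof (induction A arbitrary: \<sigma>)
  case (Ex x A)
  define y where "y = fresh_for x (\<sigma> ` (fv A - {x}))"
  have "fv (rename (\<sigma>(x := y)) A) \<subseteq> \<sigma>(x := y) ` fv A" by (rule Ex.IH)
  then show ?case by (auto simp: Let_def image_iff simp flip: y_def split: if_splits)
next
  case (All x A)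
  define y where "y = fresh_for x (\<sigma> ` (fv A - {x}))"
  have "fv (rename (\<sigma>(x := y)) A) \<subseteq> \<sigma>(x := y) ` fv A" by (rule All.IH)
  then show ?case by (auto simp: Let_def image_iff simp flip: y_def split: if_splits)
qed (auto simp: aff_vars_rename, blast+)

lemma sat_subst:
  "sat v (subst A ys xs) \<longleftrightarrow> sat (v \<circ> upd (\<lambda>x. x) xs ys) A"
  by (simp add: subst_upd sat_rename)

text \<open>Equal lengths give each variable of \<open>xs\<close> a partner in \<open>ys\<close>, so
  none of them is left unreplaced.\<close>

lemma fv_subst:
  assumes "length ys = length xs"
  shows "fv (subst A ys xs) \<subseteq> fv A - set xs \<union> set ys"
proof
  fix z assume "z \<in> fv (subst A ys xs)"
  then obtain x where x: "x \<in> fv A" "z = upd (\<lambda>x. x) xs ys x"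
    using fv_rename[of "upd (\<lambda>x. x) xs ys" A] by (auto simp: subst_upd)
  show "z \<in> fv A - set xs \<union> set ys"
  proof (cases "map_of (zip xs ys) x")
    case None
    then have "x \<notin> set xs" by (simp add: assms)
    then show ?thesis using x by (simp add: upd_notin)
  next
    case (Some y)
    then have "y \<in> set ys" by (meson map_of_SomeD set_zip_rightD)
    then show ?thesis using x Some by (simp add: upd_def)
  qed
qed

section \<open>Quantifier blocks and conjunctions\<close>

lemma sat_Exs: "sat v (Exs xs A) \<longleftrightarrow> (\<exists>w. (\<forall>x. x \<notin> set xs \<longrightarrow> w x = v x) \<and> sat w A)"
proof (induction xs arbitrary: v)
  case Nil
  have "(\<forall>x. w x = v x) \<longleftrightarrow> w = v" for w by auto
  then show ?case by (simp add: Exs_def)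
next
  case (Cons y xs)
  \<comment> \<open>The head quantifier is peeled off by choosing for it the value
    \<open>w y\<close> that the final valuation already has there.\<close>
  have "(\<forall>x. x \<notin> set (y # xs) \<longrightarrow> w x = v x) \<longleftrightarrow> (\<exists>a. \<forall>x. x \<notin> set xs \<longrightarrow> w x = (v(y := a)) x)" for w
    by (auto intro!: exI[of _ "w y"])
  with Cons show ?case by (simp only: Exs_def foldr.simps o_apply sat.simps) blast
qed

lemma sat_Alls: "sat v (Alls xs A) \<longleftrightarrow> (\<forall>w. (\<forall>x. x \<notin> set xs \<longrightarrow> w x = v x) \<longrightarrow> sat w A)"
proof -
  have "sat v (Alls xs A) \<longleftrightarrow> \<not> sat v (Exs xs (Neg A))"
    by (induction xs arbitrary: v) (simp_all add: Alls_def Exs_def)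
  then show ?thesis unfolding sat_Exs sat.simps by blast
qed

lemma fv_Exs: "fv (Exs xs A) = fv A - set xs"
  by (induction xs) (auto simp: Exs_def)

lemma fv_Conj: "fv (Conj As) = (\<Union>A \<in> set As. fv A)"
  by (induction As) (auto simp: Conj_def)

lemma sat_Conj: "sat v (Conj As) \<longleftrightarrow> (\<forall>A \<in> set As. sat v A)"
  by (induction As) (auto simp: Conj_def)

section \<open>Free variables of the transition relation\<close>

lemmas vars_defs = svars_def svars'_def svars''_def pvars_def pvars'_def qvars'_def

lemma fv_linear_test: "linear_test m t \<Longrightarrow> fv t \<subseteq> set (svars m)"
  by (induction m t rule: linear_test.induct) auto

lemma fv_unchanged: "fv (unchanged bs) = Sv ` set bs \<union> Sv' ` set bs"
  by (auto simp: unchanged_def fv_Conj var_aff_def)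

text \<open>In a sequence, the first part keeps only unprimed and the second only primed variables;
  the double-primed ones brought in by both substitutions are bound by the block in front.\<close>

lemma fv_sem: "wf_prog m C \<Longrightarrow> fv (sem m C) \<subseteq> set (svars m @ svars' m)"
proof (induction C)
  case (Assign a L k)
  then show ?case
    by (auto simp: fv_unchanged var_aff_def affine_def vars_defs dest!: set_zip_rightD)
next
  case (Ite t C D)
  then show ?case using fv_linear_test[of m t] by auto
next
  case (Seq C D)
  have l: "length (svars'' m) = length (svars m)" "length (svars'' m) = length (svars' m)"
    by (simp_all add: vars_defs)
  show ?case
    using Seq fv_subst[OF l(1), of "sem m D"] fv_subst[OF l(2), of "sem m C"]
    by (auto simp: fv_Exs)
qed (auto simp: fv_unchanged vars_defs)

lemma fv_loop_fm:
  "\<lbrakk>linear_test m c; wf_prog m C\<rbrakk> \<Longrightarrow> fv (loop_fm m c C) \<subseteq> set (svars m @ svars' m)"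
  using fv_linear_test[of m c] fv_sem[of m C] by (auto simp: loop_fm_def)

text \<open>Passes between \<open>models\<close> and \<open>sat\<close>: the default value 0 used by
  \<open>models\<close> is invisible to a formula whose free variables are all listed.\<close>

lemma models_map:
  assumes "distinct xs" "fv A \<subseteq> set xs"
  shows "models xs (map v xs) A \<longleftrightarrow> sat v A"
  unfolding models_upd
proof (rule sat_cong)
  fix x assume "x \<in> fv A"
  with assms(2) obtain j where "j < length xs" "x = xs ! j" by (metis in_set_conv_nth subsetD)
  then show "upd (\<lambda>_. 0) xs (map v xs) x = v x" using assms(1) by (simp add: upd_nth)
qed

section \<open>Meaning of the templates and of the two formulas\<close>

lemma aff_val_affine: "aff_val v (affine m L k) = lin L (map v (svars m)) + k"
  by (simp add: affine_def lin_def zip_map2 split_def o_def)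

text \<open>One valuation supplies both the state, through \<open>svars m\<close>, and the bounds,
  through \<open>xs\<close>; the length condition in \<open>region\<close> is then
  automatic.\<close>

lemma sat_template:
  assumes "length xs = length Ls"
  shows "sat v (template m Ls xs) \<longleftrightarrow> map v (svars m) \<in> region m Ls (map v xs)"
proof -
  have "sat v (template m Ls xs) \<longleftrightarrow>
      (\<forall>(L, x) \<in> set (zip Ls xs). lin L (map v (svars m)) \<le> v x)"
    by (auto simp: template_def sat_Conj aff_val_affine var_aff_def)
  also have "\<dots> \<longleftrightarrow> (\<forall>j < length Ls. lin (Ls ! j) (map v (svars m)) \<le> map v xs ! j)"
    using assms by (auto simp: set_zip)
  finally show ?thesis by (simp add: region_def svars_def)
qed

text \<open>Disjointness makes the substitution move the state to its primed copy while the
  parameters stay fixed.\<close>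

lemma sat_template_subst:
  assumes "length xs = length Ls" "set xs \<inter> set (svars m) = {}"
  shows "sat v (subst (template m Ls xs) (svars' m) (svars m)) \<longleftrightarrow>
    map v (svars' m) \<in> region m Ls (map v xs)"
proof -
  let ?w = "v \<circ> upd (\<lambda>x. x) (svars m) (svars' m)"
  have "map ?w (svars m) = map v (svars' m)"
    using map_upd[of "svars m" "svars' m" "\<lambda>x. x"]
    by (simp add: vars_defs distinct_map inj_on_def flip: map_map)
  moreover have "map ?w xs = map v xs"
    using assms(2) by (auto simp: upd_notin disjoint_iff)
  ultimately show ?thesis
    unfolding sat_subst sat_template[OF assms(1)] by (simp only:)
qed

text \<open>The first conjunct of H is the containment of regions, the second is inductiveness.
  Valuations ranging over the quantified block correspond to states, or pairs of states, with the
  parameters read from \<open>v\<close>.\<close>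

lemma sat_H_fm:
  fixes G :: "'k::linordered_field fm"
  assumes G: "fv G \<subseteq> set (svars m @ svars' m)"
  shows "sat v (H_fm m Ls Ls' G) \<longleftrightarrow>
    inductive_invariant m G (region m Ls' (map v (pvars' (length Ls')))) \<and>
    region m Ls (map v (pvars (length Ls))) \<subseteq> region m Ls' (map v (pvars' (length Ls')))"
proof -
  let ?P = "pvars (length Ls)" and ?P' = "pvars' (length Ls')"
  let ?R = "region m Ls (map v ?P)" and ?R' = "region m Ls' (map v ?P')"
  define F where "F = template m Ls ?P"
  define F' where "F' = template m Ls' ?P'"
  have len: "length ?P = length Ls" "length ?P' = length Ls'" by (simp_all add: vars_defs)
  have dist: "distinct (svars m)" "distinct (svars m @ svars' m)"
    by (auto simp: vars_defs distinct_map inj_on_def)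
  have disj: "set ?P' \<inter> set (svars m) = {}" by (auto simp: vars_defs)
  have R_len: "length s = m" if "s \<in> ?R \<or> s \<in> ?R'" for s
    using that by (auto simp: region_def)
  \<comment> \<open>Quantifying over program variables changes neither region.\<close>
  have keep: "map w ?P = map v ?P" "map w ?P' = map v ?P'"
    if "\<forall>x. x \<notin> set (svars m @ svars' m) \<longrightarrow> w x = v x" for w
    using that by (auto simp: vars_defs)
  have "sat v (Alls (svars m) (Imp F F')) \<longleftrightarrow> ?R \<subseteq> ?R'"
  proof
    assume sat: "sat v (Alls (svars m) (Imp F F'))"
    show "?R \<subseteq> ?R'"
    proof
      fix s assume s: "s \<in> ?R"
      \<comment> \<open>An arbitrary state is realised as a valuation of the quantified
        block.\<close>
      define w where "w = upd v (svars m) s"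
      have w: "\<forall>x. x \<notin> set (svars m) \<longrightarrow> w x = v x" by (simp add: w_def upd_notin)
      have "map w (svars m) = s"
        unfolding w_def using dist R_len s by (intro map_upd) (auto simp: vars_defs)
      moreover have "map w ?P = map v ?P" "map w ?P' = map v ?P'" using keep[of w] w by simp_all
      moreover have "sat w (Imp F F')" using sat w unfolding sat_Alls by blast
      ultimately show "s \<in> ?R'"
        using s unfolding F_def F'_def sat.simps sat_template[OF len(1)] sat_template[OF len(2)]
        by (simp only:)
    qed
  next
    assume sub: "?R \<subseteq> ?R'"
    show "sat v (Alls (svars m) (Imp F F'))"
      unfolding sat_Alls F_def F'_def sat.simps sat_template[OF len(1)] sat_template[OF len(2)]
      using sub keep by (metis UnCI set_append subsetD)
  qed
  moreover have "sat v (Alls (svars m @ svars' m) (Imp (And F' G) (subst F' (svars' m) (svars m))))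
      \<longleftrightarrow> inductive_invariant m G ?R'" (is "?step \<longleftrightarrow> _")
  proof
    assume sat: ?step
    have "s' \<in> ?R'"
      if s: "s \<in> ?R'" "length s' = m" "models (svars m @ svars' m) (s @ s') G" for s s'
    proof -
      define w where "w = upd v (svars m @ svars' m) (s @ s')"
      have w: "\<forall>x. x \<notin> set (svars m @ svars' m) \<longrightarrow> w x = v x"
        unfolding w_def by (intro allI impI upd_notin)
      have all: "map w (svars m @ svars' m) = s @ s'"
        unfolding w_def using dist R_len s by (intro map_upd) (auto simp: vars_defs)
      then have "map w (svars m) = s" "map w (svars' m) = s'"
        using R_len s by (auto simp: vars_defs)
      moreover have "sat w G"
        using s(3) models_map[OF dist(2) G, of w] unfolding all by simp
      moreover have "sat w (Imp (And F' G) (subst F' (svars' m) (svars m)))"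
        using sat w unfolding sat_Alls by blast
      ultimately show "s' \<in> ?R'"
        using s(1) keep[OF w]
        by (simp add: F'_def sat_template len sat_template_subst[OF len(2) disj])
    qed
    then show "inductive_invariant m G ?R'"
      using R_len unfolding inductive_invariant_def by blast
  next
    assume inv: "inductive_invariant m G ?R'"
    have "sat w (Imp (And F' G) (subst F' (svars' m) (svars m)))"
      if w: "\<forall>x. x \<notin> set (svars m @ svars' m) \<longrightarrow> w x = v x" for w
    proof -
      \<comment> \<open>Conversely, the pair of states is read off the given valuation
        \<open>w\<close>.\<close>
      have "models (svars m @ svars' m) (map w (svars m) @ map w (svars' m)) G \<longleftrightarrow> sat w G"
        using models_map[OF dist(2) G, of w] by simp
      moreover have "length (map w (svars' m)) = m" by (simp add: vars_defs)
      ultimately show ?thesis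
        using inv unfolding inductive_invariant_def F'_def sat.simps
          sat_template[OF len(2)] sat_template_subst[OF len(2) disj] keep(2)[OF w]
        by blast
    qed
    then show ?step unfolding sat_Alls by blast
  qed
  ultimately show ?thesis
    unfolding H_fm_def Let_def sat.simps F_def F'_def by blast
qed

text \<open>The existential conjunct says that \<open>a\<close> is attained as an
  \<open>i\<close>-th coordinate, the universal one that \<open>a\<close> is a lower bound. Of
  \<open>G\<close> only the free variables matter.\<close>

lemma models_O_fm:
  fixes G :: "'k::linordered_field fm"
  assumes G: "fv G \<subseteq> set (svars m @ svars' m)"
    and i: "i < length Ls'" and p: "length p = length Ls"
  shows "models (pvars (length Ls) @ [Pv' i]) (p @ [a]) (O_fm m Ls Ls' G i) \<longleftrightarrow>
    least_element
      {q' ! i | q'. length q' = length Ls' \<and>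
         inductive_invariant m G (region m Ls' q') \<and> region m Ls p \<subseteq> region m Ls' q'} a"
proof -
  let ?n = "length Ls" and ?n' = "length Ls'"
  define good where "good q' \<longleftrightarrow> inductive_invariant m G (region m Ls' q') \<and>
    region m Ls p \<subseteq> region m Ls' q'" for q'
  define v where "v = upd (\<lambda>_. 0) (pvars ?n @ [Pv' i]) (p @ [a])"
  have "map v (pvars ?n @ [Pv' i]) = p @ [a]"
    unfolding v_def by (rule map_upd) (auto simp: vars_defs distinct_map inj_on_def p)
  then have v: "map v (pvars ?n) = p" "v (Pv' i) = a" by auto
  define H where "H = H_fm m Ls Ls' G"
  \<comment> \<open>Stated for every \<open>w\<close> agreeing with \<open>v\<close> on
    \<open>p\<close>, so that it covers both the overrides of \<open>p'\<close> and the composition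
    with the renaming of \<open>p'\<close> to \<open>q'\<close>.\<close>
  have H: "sat w H \<longleftrightarrow> good (map w (pvars' ?n'))"
    if "\<forall>j. w (Pv j) = v (Pv j)" for w
  proof -
    have "map w (pvars ?n) = p" using that v(1) by (auto simp: vars_defs)
    then show ?thesis by (simp add: H_def good_def sat_H_fm[OF G])
  qed
  have dist: "distinct (pvars' ?n')" "distinct (qvars' ?n')"
    by (auto simp: vars_defs distinct_map inj_on_def)
  have len: "length (pvars' ?n') = ?n'" "length (qvars' ?n') = ?n'" by (simp_all add: vars_defs)
  let ?xs = "map Pv' [j \<leftarrow> [0..<?n']. j \<noteq> i]"
  have "sat v (Exs ?xs H) \<longleftrightarrow> (\<exists>q'. length q' = ?n' \<and> good q' \<and> q' ! i = a)"
  proof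
    assume "sat v (Exs ?xs H)"
    then obtain w where w: "\<forall>x. x \<notin> set ?xs \<longrightarrow> w x = v x" "sat w H" by (auto simp: sat_Exs)
    then have "good (map w (pvars' ?n'))" by (subst (asm) H) auto
    moreover have "map w (pvars' ?n') ! i = a" using w i v(2) by (auto simp: vars_defs)
    ultimately show "\<exists>q'. length q' = ?n' \<and> good q' \<and> q' ! i = a"
      using len by (metis length_map)
  next
    assume "\<exists>q'. length q' = ?n' \<and> good q' \<and> q' ! i = a"
    then obtain q' where q': "length q' = ?n'" "good q'" "q' ! i = a" by blast
    define w where "w = upd v (pvars' ?n') q'"
    have wq: "map w (pvars' ?n') = q'" unfolding w_def using dist len q' by (simp add: map_upd)
    have off: "w x = v x" if "x \<notin> set (pvars' ?n')" for x
      using that by (simp add: w_def upd_notin)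
    have "\<forall>j. w (Pv j) = v (Pv j)" using off by (auto simp: vars_defs)
    then have "sat w H" using H[of w] q'(2) unfolding wq by blast
    \<comment> \<open>The override covers all of \<open>p'\<close>, but the block omits
      \<open>Pv' i\<close>; agreement with \<open>v\<close> there comes from
      \<open>q' ! i = a\<close>.\<close>
    have "w (Pv' i) = a"
      using arg_cong[OF wq, of "\<lambda>q. q ! i"] i q'(3) by (simp add: vars_defs)
    moreover have "set (pvars' ?n') \<subseteq> insert (Pv' i) (set ?xs)" by (auto simp: vars_defs)
    ultimately have "w x = v x" if "x \<notin> set ?xs" for x
      using that off[of x] v(2) by (metis insertE subsetD)
    with \<open>sat w H\<close> show "sat v (Exs ?xs H)" unfolding sat_Exs by blast
  qed
  moreover have "sat v (Alls (qvars' ?n')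
      (Imp (subst H (qvars' ?n') (pvars' ?n')) (Le (var_aff (Pv' i)) (var_aff (Qv' i)))))
      \<longleftrightarrow> (\<forall>q'. length q' = ?n' \<and> good q' \<longrightarrow> a \<le> q' ! i)" (is "sat v (Alls _ ?B) \<longleftrightarrow> _")
  proof -
    have B: "sat w ?B \<longleftrightarrow> (good (map w (qvars' ?n')) \<longrightarrow> a \<le> map w (qvars' ?n') ! i)"
      if off: "\<forall>x. x \<notin> set (qvars' ?n') \<longrightarrow> w x = v x" for w
    proof -
      \<comment> \<open>Evaluating \<open>H[q'/p']\<close> at \<open>w\<close> is evaluating
        \<open>H\<close> at \<open>?u\<close>, which reads the values of \<open>q'\<close> in place
        of \<open>p'\<close>.\<close>
      let ?u = "w \<circ> upd (\<lambda>x. x) (pvars' ?n') (qvars' ?n')"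
      have "map ?u (pvars' ?n') = map w (qvars' ?n')"
        using map_upd[OF dist(1), of "qvars' ?n'" "\<lambda>x. x"] len by (simp flip: map_map)
      moreover have "sat ?u H \<longleftrightarrow> good (map ?u (pvars' ?n'))"
      proof (intro H allI)
        fix j
        have "Pv j \<notin> set (pvars' ?n')" "Pv j \<notin> set (qvars' ?n')" by (auto simp: vars_defs)
        then show "?u (Pv j) = v (Pv j)" using off by (simp add: upd_notin)
      qed
      \<comment> \<open>The inequality lies outside the substitution, so its \<open>Pv' i\<close>
        still denotes \<open>a\<close>.\<close>
      moreover have "w (Pv' i) = a" using off v(2) by (auto simp: vars_defs)
      moreover have "map w (qvars' ?n') ! i = w (Qv' i)" using i by (simp add: vars_defs)
      ultimately show ?thesis by (simp add: sat_subst var_aff_def)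
    qed
    show ?thesis
    proof
      assume sat: "sat v (Alls (qvars' ?n') ?B)"
      show "\<forall>q'. length q' = ?n' \<and> good q' \<longrightarrow> a \<le> q' ! i"
      proof (intro allI impI)
        fix q' assume q': "length q' = ?n' \<and> good q'"
        define w where "w = upd v (qvars' ?n') q'"
        have wq: "map w (qvars' ?n') = q'" unfolding w_def using dist len q' by (simp add: map_upd)
        have off: "\<forall>x. x \<notin> set (qvars' ?n') \<longrightarrow> w x = v x" by (simp add: w_def upd_notin)
        with sat have "sat w ?B" unfolding sat_Alls by blast
        then show "a \<le> q' ! i" using B[OF off] q' unfolding wq by blast
      qed
    next
      assume "\<forall>q'. length q' = ?n' \<and> good q' \<longrightarrow> a \<le> q' ! i"
      then show "sat v (Alls (qvars' ?n') ?B)"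
        unfolding sat_Alls using B len by (metis length_map)
    qed
  qed
  ultimately have "sat v (O_fm m Ls Ls' G i) \<longleftrightarrow>
      least_element {q' ! i | q'. length q' = ?n' \<and> good q'} a"
    by (auto simp: O_fm_def Let_def least_element_def simp flip: H_def)
  then show ?thesis by (simp add: models_upd v_def good_def)
qed

theorem lemma2:
  "(\<forall>m (c :: rat fm) C Ls Ls' i p a.
      linear_test m c \<and> wf_prog m C \<and> linear_forms m Ls \<and> linear_forms m Ls' \<and>
      i < length Ls' \<and> length p = length Ls \<longrightarrow>
      (models (pvars (length Ls) @ [Pv' i]) (p @ [a]) (O_fm m Ls Ls' (loop_fm m c C) i) \<longleftrightarrow>
       least_element
         {q' ! i | q'. length q' = length Ls' \<and>
            inductive_invariant m (loop_fm m c C) (region m Ls' q') \<and>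
            region m Ls p \<subseteq> region m Ls' q'} a)) \<and>
   (\<forall>m (c :: real fm) C Ls Ls' i p a.
      linear_test m c \<and> wf_prog m C \<and> linear_forms m Ls \<and> linear_forms m Ls' \<and>
      i < length Ls' \<and> length p = length Ls \<longrightarrow>
      (models (pvars (length Ls) @ [Pv' i]) (p @ [a]) (O_fm m Ls Ls' (loop_fm m c C) i) \<longleftrightarrow>
       least_element
         {q' ! i | q'. length q' = length Ls' \<and>
            inductive_invariant m (loop_fm m c C) (region m Ls' q') \<and>
            region m Ls p \<subseteq> region m Ls' q'} a))"
  \<comment> \<open>Both fields are instances of the same lemma over an arbitrary linearly ordered
    field; \<open>fv_loop_fm\<close> discharges its condition on free variables.\<close>
  by (intro conjI allI impI models_O_fm fv_loop_fm) auto

end
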